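(* The operations $G'_\theta$ and $H'_\theta$, $\theta\in[0,\pi)$, acting on a pencil $CF$ of conics sharing the focus $F$, define an abelian group (under composition), with $$G'_\theta={H'_\theta}^{-1}\qquad\text{and}\qquad G'_\theta\circ G'_\phi=G'_{2\cos^{-1}\left(\cos\left(\frac\theta2\right)\cos\left(\frac\phi2\right)\right)}$$ for all $\theta,\phi\in[0,\pi)$.
   Context: Work in the real projective plane containing $\mathbb{R}^2$. Let $C$ be a nondegenerate conic with focus $F$ and let $\theta\in[0,\pi)$. $G'_\theta(C)$ is the locus of points $Z$ such that $Z$ is the intersection of the tangents to $C$ at points $X,Y\in C$ satisfying $\angle XFY=\theta$. $H'_\theta(C)$ is the curve enveloped by the lines $XY$ for $X,Y\in C$ satisfying $\angle XFY=\theta$. (For $\theta=0$, $X=Y$, the intersection of tangents is $X$ and the line $XY$ is the tangent at $X$.) When $C$ is a hyperbola or parabola the rays from $F$ used in measuring angles may wrap around through infinity: in polar coordinates $(r,\varphi)$ centered at $F$ with $C$ given by $r(1+e\cos\varphi)=\ell$, $\ell>0$, $e\ge0$, $r$ allowed negative or infinite, each point of $C$ has a unique angle $\varphi$ mod $2\pi$, and $\angle XFY=\theta$ means $\varphi(Y)-\varphi(X)\equiv\pm\theta$ mod $2\pi$. The pencil $CF$: fix a circle centered at $F$ and let $d$ be reciprocation (polar duality) with respect to it. Fix a point $O$ and let $OF$ be the family of all circles (of positive radius) centered at $O$. $CF$ is the family of conics $d(c)$, $c\in OF$; all of them have $F$ as a focus. *)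

theory Defs
  imports "HOL-Analysis.Analysis" "HOL-Algebra.Group"
begin

text \<open>
  The real projective plane is modelled by the subspaces of \<^typ>\<open>real^3\<close>: points are the
  one-dimensional ones, lines the two-dimensional ones, incidence is inclusion. The affine point
  \<open>x\<close> of \<^typ>\<open>real^2\<close> is the point with homogeneous coordinates \<open>(x, 1)\<close>; the line at infinity
  is \<open>v $ 3 = 0\<close>.
\<close>

type_synonym ppoint = "(real^3) set"
type_synonym pline = "(real^3) set"

definition hom_coords :: "real^2 \<Rightarrow> real \<Rightarrow> real^3" where
  "hom_coords x w = vector [x $ 1, x $ 2, w]"

definition xy_part :: "real^3 \<Rightarrow> real^2" where
  "xy_part v = vector [v $ 1, v $ 2]"

definition unit_dir :: "real \<Rightarrow> real^2" where
  "unit_dir t = vector [cos t, sin t]"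

definition affine_pt :: "real^2 \<Rightarrow> ppoint" where
  "affine_pt x = span {hom_coords x 1}"

text \<open>
  A tangent is spanned by position and velocity of a regularly parametrised arc of the curve in
  homogeneous coordinates; the velocity condition says that the arc is immersed projectively.
\<close>

definition tangent_at :: "ppoint set \<Rightarrow> ppoint \<Rightarrow> pline \<Rightarrow> bool" where
  "tangent_at S X L \<longleftrightarrow>
     (\<exists>(g :: real \<Rightarrow> real^3) g' t.
        (\<forall>s. g s \<noteq> 0 \<and> span {g s} \<in> S \<and> (g has_vector_derivative g' s) (at s)) \<and>
        X = span {g t} \<and> g' t \<notin> span {g t} \<and> L = span {g t, g' t})"

text \<open>
  The envelope of a one-parameter family of lines consists of its characteristic points. If
  \<open>a s \<bullet> v = 0\<close> is the equation of the moving line, the characteristic point at \<open>t\<close> is given by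
  \<open>a t \<bullet> v = 0\<close> and the differentiated equation \<open>a' t \<bullet> v = 0\<close>. It is unchanged when \<open>a\<close> is
  rescaled or reparametrised, so the family need only be given as a set of lines.
\<close>

definition envelope :: "pline set \<Rightarrow> ppoint set" where
  "envelope \<L> =
     {Z. \<exists>(a :: real \<Rightarrow> real^3) a' t.
        (\<forall>s. a s \<noteq> 0 \<and> {v. a s \<bullet> v = 0} \<in> \<L> \<and> (a has_vector_derivative a' s) (at s)) \<and>
        a' t \<notin> span {a t} \<and> Z = {v. a t \<bullet> v = 0 \<and> a' t \<bullet> v = 0}}"

text \<open>
  Polar coordinates centred at \<open>F\<close>, with zero ray in direction \<open>\<alpha>\<close>: this is the point at angle
  \<open>\<phi>\<close> with \<open>r = l / (1 + e cos \<phi>)\<close>, that is \<open>F + r u\<close> for the unit vector \<open>u\<close> in direction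
  \<open>\<alpha> + \<phi>\<close>, multiplied through by \<open>1 + e cos \<phi>\<close>. If \<open>1 + e cos \<phi> = 0\<close> then \<open>r\<close> is infinite and
  this is the point at infinity in direction \<open>u\<close>.
\<close>

definition focal_pt :: "real^2 \<Rightarrow> real \<Rightarrow> real \<Rightarrow> real \<Rightarrow> real \<Rightarrow> ppoint" where
  "focal_pt F l e \<alpha> \<phi> =
     span {hom_coords ((1 + e * cos \<phi>) *\<^sub>R F + l *\<^sub>R unit_dir (\<alpha> + \<phi>)) (1 + e * cos \<phi>)}"

text \<open>
  The numbers \<open>l\<close>, \<open>e\<close> and (unless \<open>e = 0\<close>) \<open>\<alpha>\<close> modulo \<open>2 pi\<close> are determined by the conic \<open>C\<close>
  and its focus \<open>F\<close>, hence so are differences of polar angles.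
\<close>

definition focal_angle :: "real^2 \<Rightarrow> ppoint set \<Rightarrow> real \<Rightarrow> ppoint \<Rightarrow> ppoint \<Rightarrow> bool" where
  "focal_angle F C \<theta> X Y \<longleftrightarrow>
     (\<exists>l e \<alpha> \<phi> \<psi>. l > 0 \<and> e \<ge> 0 \<and> C = range (focal_pt F l e \<alpha>) \<and>
        X = focal_pt F l e \<alpha> \<phi> \<and> Y = focal_pt F l e \<alpha> \<psi> \<and>
        (\<exists>k::int. \<psi> - \<phi> = \<theta> + 2 * pi * of_int k \<or> \<psi> - \<phi> = - \<theta> + 2 * pi * of_int k))"

definition G_op :: "real^2 \<Rightarrow> real \<Rightarrow> ppoint set \<Rightarrow> ppoint set" where
  "G_op F \<theta> C =
     {Z. \<exists>X Y. focal_angle F C \<theta> X Y \<and>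
        (if X = Y then Z = X
         else \<exists>L M. tangent_at C X L \<and> tangent_at C Y M \<and> Z = L \<inter> M)}"

definition H_op :: "real^2 \<Rightarrow> real \<Rightarrow> ppoint set \<Rightarrow> ppoint set" where
  "H_op F \<theta> C =
     envelope {L. \<exists>X Y. focal_angle F C \<theta> X Y \<and>
        (if X = Y then tangent_at C X L else L = span (X \<union> Y))}"

text \<open>
  Polarity in the circle with centre \<open>F\<close> and radius \<open>\<rho>\<close>, mapping points to lines and lines to
  points: affine points \<open>p\<close>, \<open>q\<close> are conjugate iff \<open>(p - F) \<bullet> (q - F) = \<rho>\<^sup>2\<close>.
\<close>

definition polarity :: "real^2 \<Rightarrow> real \<Rightarrow> (real^3) set \<Rightarrow> (real^3) set" where
  "polarity F \<rho> U =
     {v. \<forall>u\<in>U. (xy_part u - (u $ 3) *\<^sub>R F) \<bullet> (xy_part v - (v $ 3) *\<^sub>R F) = \<rho>\<^sup>2 * (u $ 3) * (v $ 3)}"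

text \<open>The reciprocal of a curve is the locus of the poles of its tangents.\<close>

definition reciprocal :: "real^2 \<Rightarrow> real \<Rightarrow> ppoint set \<Rightarrow> ppoint set" where
  "reciprocal F \<rho> S = {polarity F \<rho> L | L X. X \<in> S \<and> tangent_at S X L}"

definition circles_at :: "real^2 \<Rightarrow> ppoint set set" where
  "circles_at c = {affine_pt ` sphere c R | R. R > 0}"

definition focal_pencil :: "real^2 \<Rightarrow> real \<Rightarrow> real^2 \<Rightarrow> ppoint set set" where
  "focal_pencil F \<rho> c = reciprocal F \<rho> ` circles_at c"

definition G_map :: "real^2 \<Rightarrow> real \<Rightarrow> real^2 \<Rightarrow> real \<Rightarrow> ppoint set \<Rightarrow> ppoint set" where
  "G_map F \<rho> c \<theta> = restrict (G_op F \<theta>) (focal_pencil F \<rho> c)"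

definition H_map :: "real^2 \<Rightarrow> real \<Rightarrow> real^2 \<Rightarrow> real \<Rightarrow> ppoint set \<Rightarrow> ppoint set" where
  "H_map F \<rho> c \<theta> = restrict (H_op F \<theta>) (focal_pencil F \<rho> c)"

definition pencil_ops :: "real^2 \<Rightarrow> real \<Rightarrow> real^2 \<Rightarrow> (ppoint set \<Rightarrow> ppoint set) monoid" where
  "pencil_ops F \<rho> c =
     \<lparr>carrier = G_map F \<rho> c ` {0..<pi} \<union> H_map F \<rho> c ` {0..<pi},
      monoid.mult = compose (focal_pencil F \<rho> c),
      one = restrict id (focal_pencil F \<rho> c)\<rparr>"

end

theory Submission
  imports Defs
begin

text \<open>
  One linear change of homogeneous coordinates turns all conics of the pencil simultaneously into
  concentric circles: the reciprocal of the circle of radius \<open>R\<close> becomes the curve of the points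
  \<open>(cos t, sin t, R)\<close>, and \<open>t\<close> is the polar angle at \<open>F\<close>. Tangents, joins and envelopes are
  projective notions. For concentric circles, the tangents at \<open>m - \<theta>/2\<close> and \<open>m + \<theta>/2\<close> meet at
  \<open>(cos m, sin m, R cos (\<theta>/2))\<close>, and the chord between these points touches the curve with parameter
  \<open>R / cos (\<theta>/2)\<close>. Hence \<open>G\<close> and \<open>H\<close> multiply \<open>R\<close> by \<open>cos (\<theta>/2)\<close> and its reciprocal, and the
  group is the multiplicative group of positive reals.
\<close>

section \<open>Circles about the origin in homogeneous coordinates\<close>

definition cone_vec :: "real \<Rightarrow> real \<Rightarrow> real^3" where
  "cone_vec r t = vector [cos t, sin t, r]"

text \<open>For \<open>r > 0\<close> this is the point at polar angle \<open>t\<close> on the circle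
  of radius \<open>1 / r\<close> about the origin, so a larger \<open>r\<close> means a smaller
  circle.\<close>

definition cone_pt :: "real \<Rightarrow> real \<Rightarrow> ppoint" where
  "cone_pt r t = span {cone_vec r t}"

text \<open>The equation of the tangent of that circle at the point with angle \<open>t\<close>; in
  affine coordinates it reads \<open>x cos t + y sin t = 1 / r\<close>.\<close>

definition cone_plane :: "real \<Rightarrow> real \<Rightarrow> pline" where
  "cone_plane r t = {v. r * (v $ 1 * cos t + v $ 2 * sin t) = v $ 3}"

lemma cone_vec_nth [simp]:
  "cone_vec r t $ 1 = cos t" "cone_vec r t $ 2 = sin t" "cone_vec r t $ 3 = r"
  by (simp_all add: cone_vec_def)

lemma cone_vec_nonzero: "r > 0 \<Longrightarrow> cone_vec r t \<noteq> 0"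
  by (auto simp: vec_eq_iff forall_3)

lemma vector_3_has_vector_derivative:
  assumes "(f has_real_derivative f') (at t)" "(g has_real_derivative g') (at t)"
    "(h has_real_derivative h') (at t)"
  shows "((\<lambda>s. vector [f s, g s, h s] :: real^3) has_vector_derivative vector [f', g', h']) (at t)"
proof -
  have expand: "vector [x, y, z] = x *\<^sub>R axis 1 1 + y *\<^sub>R axis 2 1 + z *\<^sub>R (axis 3 1 :: real^3)"
    for x y z :: real
    by (auto simp: vec_eq_iff forall_3 axis_def)
  show ?thesis
    unfolding expand using assms
    by (auto intro!: derivative_eq_intros)
qed

lemma nth_has_real_derivative:
  fixes g :: "real \<Rightarrow> real^'n"
  assumes "(g has_vector_derivative g') (at t)"
  shows "((\<lambda>s. g s $ i) has_real_derivative g' $ i) (at t)"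
  using bounded_linear.has_vector_derivative[OF bounded_linear_vec_nth assms, of i]
  by (simp add: has_real_derivative_iff_has_vector_derivative)

lemma span_singleton_scaleR: "k \<noteq> 0 \<Longrightarrow> span {k *\<^sub>R y} = span {y :: 'a::real_vector}"
  using span_image_scale[of "{y}" "\<lambda>_. k"] by simp

lemma span_singleton_eq_iff:
  assumes "x \<noteq> 0"
  shows "span {x} = span {y :: 'a::real_vector} \<longleftrightarrow> (\<exists>k. k \<noteq> 0 \<and> x = k *\<^sub>R y)"
proof
  assume "span {x} = span {y}"
  then have "x \<in> span {y}"
    using span_base by blast
  then show "\<exists>k. k \<noteq> 0 \<and> x = k *\<^sub>R y"
    using assms by (auto simp: span_singleton)
next
  assume "\<exists>k. k \<noteq> 0 \<and> x = k *\<^sub>R y"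
  then show "span {x} = span {y}"
    by (elim exE conjE) (simp add: span_singleton_scaleR)
qed

text \<open>The components of \<open>(x, y)\<close> along and across the direction \<open>t\<close>
  recover \<open>x\<close> and \<open>y\<close>, because the direction and its quarter turn are
  orthonormal.\<close>

lemma rotation_inverse:
  "(x * cos t + y * sin t) * cos t - (y * cos t - x * sin t) * sin t = (x::real)"
  "(x * cos t + y * sin t) * sin t + (y * cos t - x * sin t) * cos t = (y::real)"
  using sin_cos_squared_add[of t] by algebra+

text \<open>The second spanning vector is the derivative of \<open>cone_vec r\<close> at
  \<open>t\<close>, so the equation of the tangent line agrees with the span of position and
  velocity.\<close>

lemma cone_plane_eq_span:
  "cone_plane r t = span {cone_vec r t, vector [- sin t, cos t, 0]}"
proof (intro equalityI subsetI)
  fix v assume "v \<in> cone_plane r t"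
  then have v: "v $ 3 = r * (v $ 1 * cos t + v $ 2 * sin t)"
    by (simp add: cone_plane_def)
  have "v = (v $ 1 * cos t + v $ 2 * sin t) *\<^sub>R cone_vec r t
          + (v $ 2 * cos t - v $ 1 * sin t) *\<^sub>R vector [- sin t, cos t, 0]"
    using v by (simp add: vec_eq_iff forall_3 rotation_inverse)
  also have "\<dots> \<in> span {cone_vec r t, vector [- sin t, cos t, 0]}"
    by (intro span_add span_scale span_base) auto
  finally show "v \<in> span {cone_vec r t, vector [- sin t, cos t, 0]}" .
next
  have "cone_plane r t = {v. vector [r * cos t, r * sin t, - 1] \<bullet> v = 0}"
    by (auto simp: cone_plane_def inner_vec_def sum_3 algebra_simps)
  then have "subspace (cone_plane r t)"
    by (simp add: subspace_hyperplane)
  moreover have "cone_vec r t \<in> cone_plane r t" "vector [- sin t, cos t, 0] \<in> cone_plane r t"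
    by (simp_all add: cone_plane_def flip: power2_eq_square)
  ultimately have "span {cone_vec r t, vector [- sin t, cos t, 0]} \<subseteq> cone_plane r t"
    by (intro span_minimal) auto
  then show "v \<in> cone_plane r t" if "v \<in> span {cone_vec r t, vector [- sin t, cos t, 0]}" for v
    using that by blast
qed

text \<open>For an arbitrary regular arc on the circle, differentiating the quadratic equation of
  the circle puts the velocity into the plane \<open>cone_plane r u\<close>; independence of
  position and velocity makes their span the whole plane. Conversely, \<open>cone_vec r\<close> is
  itself a regular arc.\<close>

lemma tangent_at_cone:
  assumes "r > 0"
  shows "tangent_at (range (cone_pt r)) X L \<longleftrightarrow> (\<exists>t. X = cone_pt r t \<and> L = cone_plane r t)"
proof
  assume "tangent_at (range (cone_pt r)) X L"
  then obtain g g' t where g: "\<And>s. g s \<noteq> 0" "\<And>s. span {g s} \<in> range (cone_pt r)"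
      "\<And>s. (g has_vector_derivative g' s) (at s)"
    and X: "X = span {g t}" and g't: "g' t \<notin> span {g t}" and L: "L = span {g t, g' t}"
    unfolding tangent_at_def by blast
  have on_cone: "\<exists>k u. k \<noteq> 0 \<and> g s = k *\<^sub>R cone_vec r u" for s
    using g(2)[of s] unfolding cone_pt_def image_iff span_singleton_eq_iff[OF g(1)] by blast
  \<comment> \<open>The scale \<open>k\<close> and angle \<open>u\<close> are chosen separately for
    each \<open>s\<close>, with no smoothness in \<open>s\<close>. The homogeneous equation
    eliminates both and can be differentiated.\<close>
  have quad: "r\<^sup>2 * ((g s $ 1)\<^sup>2 + (g s $ 2)\<^sup>2) - (g s $ 3)\<^sup>2 = 0" for s
  proof -
    obtain k u where "g s = k *\<^sub>R cone_vec r u" using on_cone by blast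
    then have "r\<^sup>2 * ((g s $ 1)\<^sup>2 + (g s $ 2)\<^sup>2) - (g s $ 3)\<^sup>2 = k\<^sup>2 * r\<^sup>2 * ((cos u)\<^sup>2 + (sin u)\<^sup>2 - 1)"
      by (simp add: power_mult_distrib algebra_simps del: sin_cos_squared_add sin_cos_squared_add2)
    then show ?thesis by simp
  qed
  have "((\<lambda>s. r\<^sup>2 * ((g s $ 1)\<^sup>2 + (g s $ 2)\<^sup>2) - (g s $ 3)\<^sup>2) has_real_derivative
      r\<^sup>2 * (2 * g t $ 1 * g' t $ 1 + 2 * g t $ 2 * g' t $ 2) - 2 * g t $ 3 * g' t $ 3) (at t)"
    by (auto intro!: derivative_eq_intros nth_has_real_derivative[OF g(3)])
  moreover have "((\<lambda>s. r\<^sup>2 * ((g s $ 1)\<^sup>2 + (g s $ 2)\<^sup>2) - (g s $ 3)\<^sup>2) has_real_derivative 0) (at t)"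
    unfolding quad by simp
  ultimately have polar:
    "r\<^sup>2 * (2 * g t $ 1 * g' t $ 1 + 2 * g t $ 2 * g' t $ 2) - 2 * g t $ 3 * g' t $ 3 = 0"
    using DERIV_unique by blast
  obtain k u where k: "k \<noteq> 0" and gt: "g t = k *\<^sub>R cone_vec r u" using on_cone by blast
  let ?n = "vector [- sin u, cos u, 0] :: real^3"
  \<comment> \<open>The polar equation at the point of contact, with the nonzero factor
    \<open>2 * k * r\<close> split off, is the equation of the plane.\<close>
  have "2 * k * r * (r * (g' t $ 1 * cos u + g' t $ 2 * sin u) - g' t $ 3) = 0"
    using polar by (simp add: gt power2_eq_square algebra_simps)
  then have "g' t \<in> cone_plane r u"
    using k assms by (simp add: cone_plane_def)
  then obtain a b where g': "g' t = a *\<^sub>R cone_vec r u + b *\<^sub>R ?n"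
    unfolding cone_plane_eq_span by (auto simp: span_breakdown_eq algebra_simps)
  have X': "X = cone_pt r u"
    unfolding X cone_pt_def span_singleton_eq_iff[OF g(1)] using k gt by blast
  \<comment> \<open>Here the immersion condition enters: a velocity without a component along
    \<open>?n\<close> would be a multiple of the position.\<close>
  have "b \<noteq> 0"
  proof
    assume "b = 0"
    then have "g' t \<in> X"
      by (simp add: X' cone_pt_def g' span_base span_scale)
    with g't X show False by simp
  qed
  have "cone_vec r u = (1 / k) *\<^sub>R g t"
    using k gt by simp
  then have c: "cone_vec r u \<in> span {g t, g' t}"
    by (metis insertI1 span_base span_scale)
  have "?n = (1 / b) *\<^sub>R (g' t - a *\<^sub>R cone_vec r u)"
    using \<open>b \<noteq> 0\<close> g' by simp
  also have "\<dots> \<in> span {g t, g' t}"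
    using c by (intro span_scale span_diff) (auto intro: span_base)
  finally have n: "?n \<in> span {g t, g' t}" .
  have "L = cone_plane r u"
    unfolding L cone_plane_eq_span
  proof (rule span_eq[THEN iffD2], intro conjI)
    show "{g t, g' t} \<subseteq> span {cone_vec r u, ?n}"
      by (auto simp: gt g' intro!: span_add span_scale intro: span_base)
    show "{cone_vec r u, ?n} \<subseteq> span {g t, g' t}"
      using c n by auto
  qed
  with X' show "\<exists>t. X = cone_pt r t \<and> L = cone_plane r t" by blast
next
  assume "\<exists>t. X = cone_pt r t \<and> L = cone_plane r t"
  then obtain t where t: "X = cone_pt r t" "L = cone_plane r t" by blast
  have "(cone_vec r has_vector_derivative vector [- sin s, cos s, 0]) (at s)" for s
    unfolding cone_vec_def
    by (rule vector_3_has_vector_derivative) (auto intro!: derivative_eq_intros)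
  moreover have "vector [- sin t, cos t, 0] \<notin> span {cone_vec r t}"
    using assms sin_zero_abs_cos_one[of t] by (auto simp: span_singleton vec_eq_iff forall_3)
  ultimately show "tangent_at (range (cone_pt r)) X L"
    unfolding tangent_at_def t cone_plane_eq_span
    using cone_vec_nonzero[OF assms]
    by (intro exI[of _ "cone_vec r"] exI[of _ "\<lambda>s. vector [- sin s, cos s, 0]"] exI[of _ t])
      (auto simp: cone_pt_def)
qed

section \<open>Tangents and envelopes under projective maps\<close>

lemma tangent_at_image:
  assumes A: "linear A" "bij A" and "tangent_at S X L"
  shows "tangent_at ((`) A ` S) (A ` X) (A ` L)"
proof -
  interpret linear A by (rule A(1))
  have inj: "inj A" using A(2) by (rule bij_is_inj)
  obtain g g' t where g: "\<And>s. g s \<noteq> 0" "\<And>s. span {g s} \<in> S"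
      "\<And>s. (g has_vector_derivative g' s) (at s)"
    and X: "X = span {g t}" and g't: "g' t \<notin> span {g t}" and L: "L = span {g t, g' t}"
    using assms(3) unfolding tangent_at_def by blast
  have sp: "span {A v} = A ` span {v}" for v
    using linear_span_image[OF A(1), of "{v}"] by simp
  have sp2: "span {A v, A w} = A ` span {v, w}" for v w
    using linear_span_image[OF A(1), of "{v, w}"] by simp
  have "bounded_linear A" using A(1) by (simp add: linear_conv_bounded_linear)
  then have "((\<lambda>s. A (g s)) has_vector_derivative A (g' s)) (at s)" for s
    using g(3) by (rule bounded_linear.has_vector_derivative)
  moreover have "A (g s) \<noteq> 0" for s
    using g(1) inj by (metis injD zero)
  ultimately show ?thesis
    unfolding tangent_at_def X L using g(2) g't
    by (intro exI[of _ "\<lambda>s. A (g s)"] exI[of _ "\<lambda>s. A (g' s)"] exI[of _ t])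
      (simp add: sp sp2 inj_image_mem_iff[OF inj])
qed

text \<open>Linear bijections carry regular arcs to regular arcs; the converse direction applies
  this to the inverse map.\<close>

lemma tangent_at_image_iff:
  assumes A: "linear A" "bij A"
  shows "tangent_at ((`) A ` S) X L \<longleftrightarrow> (\<exists>X' L'. X = A ` X' \<and> L = A ` L' \<and> tangent_at S X' L')"
proof
  assume t: "tangent_at ((`) A ` S) X L"
  have inv: "linear (inv_into UNIV A)" "bij (inv_into UNIV A)"
    using A by (auto simp: bij_imp_bij_inv linear_linear intro: inj_linear_imp_inv_linear bij_is_inj)
  have comp: "inv_into UNIV A ` A ` U = U" "A ` inv_into UNIV A ` U = U" for U
    using A(2) by (simp_all add: image_comp bij_is_inj bij_is_surj surj_iff[THEN iffD1])
  have "tangent_at ((`) (inv_into UNIV A) ` (`) A ` S) (inv_into UNIV A ` X) (inv_into UNIV A ` L)"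
    using inv t by (rule tangent_at_image)
  moreover have "(`) (inv_into UNIV A) ` (`) A ` S = S"
    using comp(1) by (simp only: image_image image_ident)
  ultimately have "tangent_at S (inv_into UNIV A ` X) (inv_into UNIV A ` L)" by simp
  then show "\<exists>X' L'. X = A ` X' \<and> L = A ` L' \<and> tangent_at S X' L'"
    using comp(2) by metis
qed (use tangent_at_image[OF A] in blast)

text \<open>The coefficient vectors of the lines are points of the dual plane. A moving line is then
  an arc of the dual curve, and its characteristic point is the annihilator of the tangent to that
  arc. Envelopes thereby reduce to the tangents already computed.\<close>

lemma envelope_eq_dual:
  "envelope \<L> = {Z. \<exists>X L. tangent_at {span {a} | a. a \<noteq> 0 \<and> {v. a \<bullet> v = 0} \<in> \<L>} X L \<and>
     Z = {v. \<forall>a\<in>L. a \<bullet> v = 0}}"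
proof -
  let ?S = "{span {a} | a. a \<noteq> 0 \<and> {v. a \<bullet> v = 0} \<in> \<L>}"
  \<comment> \<open>Membership must not depend on the representative: proportional coefficient
    vectors define the same line.\<close>
  have mem: "span {b} \<in> ?S \<longleftrightarrow> {v. b \<bullet> v = 0} \<in> \<L>" if "b \<noteq> 0" for b
  proof
    assume "span {b} \<in> ?S"
    then obtain a where a: "span {b} = span {a}" "{v. a \<bullet> v = 0} \<in> \<L>" by auto
    then obtain k where "k \<noteq> 0" "b = k *\<^sub>R a"
      using span_singleton_eq_iff[OF \<open>b \<noteq> 0\<close>] by blast
    then have "{v. b \<bullet> v = 0} = {v. a \<bullet> v = 0}" by simp
    with a show "{v. b \<bullet> v = 0} \<in> \<L>" by simp
  qed (use that in blast)
  then have mem': "b \<noteq> 0 \<and> span {b} \<in> ?S \<and> P \<longleftrightarrow> b \<noteq> 0 \<and> {v. b \<bullet> v = 0} \<in> \<L> \<and> P" for b P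
    by blast
  have perp: "{v. a \<bullet> v = 0 \<and> b \<bullet> v = 0} = {v. \<forall>d\<in>span {a, b}. d \<bullet> v = 0}" for a b :: "real^3"
  proof (intro equalityI subsetI)
    fix v assume "v \<in> {v. a \<bullet> v = 0 \<and> b \<bullet> v = 0}"
    then show "v \<in> {v. \<forall>d\<in>span {a, b}. d \<bullet> v = 0}"
      by (auto simp: span_breakdown_eq inner_diff_left algebra_simps dest!: arg_cong[of _ _ "\<lambda>x. x \<bullet> v"])
  qed (auto intro: span_base)
  show ?thesis
    unfolding envelope_def tangent_at_def perp
  proof (rule Collect_cong)
    fix Z
    show "(\<exists>a a' t. (\<forall>s. a s \<noteq> 0 \<and> {v. a s \<bullet> v = 0} \<in> \<L> \<and> (a has_vector_derivative a' s) (at s)) \<and>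
            a' t \<notin> span {a t} \<and> Z = {v. \<forall>d\<in>span {a t, a' t}. d \<bullet> v = 0}) \<longleftrightarrow>
          (\<exists>X L. (\<exists>g g' t. (\<forall>s. g s \<noteq> 0 \<and> span {g s} \<in> ?S \<and> (g has_vector_derivative g' s) (at s)) \<and>
            X = span {g t} \<and> g' t \<notin> span {g t} \<and> L = span {g t, g' t}) \<and>
            Z = {v. \<forall>a\<in>L. a \<bullet> v = 0})"
      unfolding mem' by blast
  qed
qed

text \<open>Orthogonality in three-space exchanges the parameters \<open>r\<close> and
  \<open>1 / r\<close>. The half turn appears because the products of the first two coordinates have
  to cancel the product of the positive third ones.\<close>

lemma cone_plane_perp:
  assumes "r > 0"
  shows "{v. \<forall>a\<in>cone_plane (1 / r) t. a \<bullet> v = 0} = cone_pt r (t + pi)"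
proof (intro equalityI subsetI)
  fix v assume v: "v \<in> {v. \<forall>a\<in>cone_plane (1 / r) t. a \<bullet> v = 0}"
  have "cone_vec (1 / r) t \<in> cone_plane (1 / r) t" "vector [- sin t, cos t, 0] \<in> cone_plane (1 / r) t"
    unfolding cone_plane_eq_span by (auto intro: span_base)
  with v have "cone_vec (1 / r) t \<bullet> v = 0" "vector [- sin t, cos t, 0] \<bullet> v = 0"
    by auto
  then have e: "v $ 3 = - r * (v $ 1 * cos t + v $ 2 * sin t)" "v $ 2 * cos t = v $ 1 * sin t"
    using assms by (auto simp: inner_vec_def sum_3 field_simps)
  have "v = - (v $ 1 * cos t + v $ 2 * sin t) *\<^sub>R cone_vec r (t + pi)"
    using e rotation_inverse[of "v $ 1" t "v $ 2"]
    by (simp add: vec_eq_iff forall_3) (simp add: algebra_simps)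
  then show "v \<in> cone_pt r (t + pi)"
    unfolding cone_pt_def by (metis span_base singletonI span_scale)
next
  have "a \<bullet> cone_vec r (t + pi) = 0" if "a \<in> cone_plane (1 / r) t" for a
    using that assms by (simp add: cone_plane_def inner_vec_def sum_3 field_simps)
  then show "v \<in> {v. \<forall>a\<in>cone_plane (1 / r) t. a \<bullet> v = 0}" if "v \<in> cone_pt r (t + pi)" for v
    using that by (auto simp: cone_pt_def span_singleton)
qed

lemma perp_eq_cone_plane_iff:
  assumes "r > 0" "n \<noteq> 0"
  shows "{v. n \<bullet> v = 0} = cone_plane r t \<longleftrightarrow> span {n} = cone_pt (1 / r) (t + pi)"
proof
  assume "{v. n \<bullet> v = 0} = cone_plane r t"
  \<comment> \<open>The parameter is written as \<open>1 / (1 / r)\<close> so that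
    \<open>cone_plane_perp\<close> applies with \<open>1 / r\<close> in the role of
    \<open>r\<close>.\<close>
  then have "n \<in> {v. \<forall>a\<in>cone_plane (1 / (1 / r)) t. a \<bullet> v = 0}"
    by (auto simp: inner_commute)
  then have "n \<in> span {cone_vec (1 / r) (t + pi)}"
    using assms(1) by (subst (asm) cone_plane_perp) (auto simp: cone_pt_def)
  then show "span {n} = cone_pt (1 / r) (t + pi)"
    using assms(2) unfolding cone_pt_def span_singleton_eq_iff[OF assms(2)] by (auto simp: span_singleton)
next
  assume "span {n} = cone_pt (1 / r) (t + pi)"
  then obtain k where "k \<noteq> 0" "n = k *\<^sub>R cone_vec (1 / r) (t + pi)"
    unfolding cone_pt_def span_singleton_eq_iff[OF assms(2)] by blast
  moreover have "cone_vec (1 / r) (t + pi) \<bullet> v = 0 \<longleftrightarrow> v \<in> cone_plane r t" for v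
    using assms(1) by (auto simp: cone_plane_def inner_vec_def sum_3 field_simps)
  ultimately show "{v. n \<bullet> v = 0} = cone_plane r t"
    by auto
qed

text \<open>Absorbs the half turn produced by duality and, later, the direction of the zero ray of
  the polar coordinates.\<close>

lemma range_cone_pt_shift: "range (\<lambda>t. f (cone_pt r (t + a))) = range (\<lambda>t. f (cone_pt r t))"
  by (auto simp: image_iff) (metis diff_add_cancel)

text \<open>Dualising twice: the tangents of the circle form, in the dual plane, a linear image of
  the circle with parameter \<open>1 / r\<close>, and the annihilators of the tangents of that curve
  are the points of the original one.\<close>

lemma envelope_cone_planes:
  fixes A :: "real^3 \<Rightarrow> real^3"
  assumes A: "linear A" "bij A" and r: "r > 0"
  shows "envelope (range (\<lambda>t. A ` cone_plane r t)) = range (\<lambda>t. A ` cone_pt r t)"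
proof -
  \<comment> \<open>When points transform by \<open>A\<close>, coefficient vectors of lines
    transform by the inverse transpose.\<close>
  define D where "D = inv_into UNIV (adjoint A)"
  have inj: "inj A" and surj: "surj A"
    using A(2) by (auto simp: bij_is_inj bij_is_surj)
  have adj: "a \<bullet> A v = adjoint A a \<bullet> v" for a v
    using adjoint_works[OF A(1)] by (simp add: inner_commute)
  have lin': "linear (adjoint A)" by (rule adjoint_linear[OF A(1)])
  have inj': "inj (adjoint A)"
  proof (rule linear_injective_0[OF lin', THEN iffD2], intro allI impI)
    fix a assume "adjoint A a = 0"
    then have "a \<bullet> A v = 0" for v by (simp add: adj)
    then have "a \<bullet> w = 0" for w using surj by (metis surjD)
    then show "a = 0" by (metis inner_eq_zero_iff)
  qed
  have bij': "bij (adjoint A)"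
    using linear_injective_imp_surjective[OF lin' inj'] inj' by (simp add: bij_def)
  have D: "linear D" "bij D"
    unfolding D_def using lin' inj' bij'
    by (auto simp: bij_imp_bij_inv linear_linear intro: inj_linear_imp_inv_linear)
  have AD: "adjoint A (D a) = a" and DA: "D (adjoint A a) = a" for a
    unfolding D_def using bij' by (auto simp: bij_is_inj bij_is_surj surj_f_inv_f)
  have spD: "span {D v} = D ` span {v}" for v
    using linear_span_image[OF D(1), of "{v}"] by simp
  have "{span {a} | a. a \<noteq> 0 \<and> {v. a \<bullet> v = 0} \<in> range (\<lambda>t. A ` cone_plane r t)}
      = (`) D ` range (cone_pt (1 / r))" (is "?S = _")
  proof -
    have line: "{v. a \<bullet> v = 0} = A ` cone_plane r t \<longleftrightarrow> span {a} = D ` cone_pt (1 / r) (t + pi)"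
      if "a \<noteq> 0" for a t
    proof -
      have nz: "adjoint A a \<noteq> 0" using that DA linear_0[OF D(1)] by metis
      have "{v. a \<bullet> v = 0} = A ` {z. adjoint A a \<bullet> z = 0}"
        unfolding adj[symmetric] using surj by (auto simp: image_iff dest: surjD)
      then have "{v. a \<bullet> v = 0} = A ` cone_plane r t \<longleftrightarrow> {z. adjoint A a \<bullet> z = 0} = cone_plane r t"
        using inj by (simp add: inj_image_eq_iff)
      also have "\<dots> \<longleftrightarrow> span {adjoint A a} = cone_pt (1 / r) (t + pi)"
        by (rule perp_eq_cone_plane_iff[OF r nz])
      also have "\<dots> \<longleftrightarrow> D ` span {adjoint A a} = D ` cone_pt (1 / r) (t + pi)"
        using D(2) by (simp add: inj_image_eq_iff bij_is_inj)
      finally show ?thesis by (simp add: DA flip: spD)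
    qed
    have "?S = range (\<lambda>t. D ` cone_pt (1 / r) (t + pi))"
    proof (intro equalityI subsetI)
      fix U assume "U \<in> range (\<lambda>t. D ` cone_pt (1 / r) (t + pi))"
      then obtain t where U: "U = span {D (cone_vec (1 / r) (t + pi))}"
        by (auto simp: cone_pt_def spD)
      have "D (cone_vec (1 / r) (t + pi)) \<noteq> 0"
        using cone_vec_nonzero r AD linear_0[OF lin'] by (metis divide_pos_pos zero_less_one)
      moreover from this have "{v. D (cone_vec (1 / r) (t + pi)) \<bullet> v = 0} = A ` cone_plane r t"
        by (simp add: line cone_pt_def spD)
      ultimately show "U \<in> ?S" using U by blast
    qed (use line in auto)
    then show ?thesis
      by (simp add: range_cone_pt_shift[of "(`) D"] image_image)
  qed
  then have tan: "tangent_at ?S X L \<longleftrightarrow> (\<exists>t. X = D ` cone_pt (1 / r) t \<and> L = D ` cone_plane (1 / r) t)" for X L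
    using r by (auto simp: tangent_at_image_iff[OF D] tangent_at_cone)
  have perp: "{v. \<forall>a\<in>D ` cone_plane (1 / r) t. a \<bullet> v = 0} = A ` cone_pt r (t + pi)" for t
  proof -
    have "{v. \<forall>a\<in>D ` cone_plane (1 / r) t. a \<bullet> v = 0} = A ` {z. \<forall>a\<in>cone_plane (1 / r) t. a \<bullet> z = 0}"
    proof (intro equalityI subsetI)
      fix v assume v: "v \<in> {v. \<forall>a\<in>D ` cone_plane (1 / r) t. a \<bullet> v = 0}"
      obtain z where "v = A z" using surj by (metis surjD)
      with v show "v \<in> A ` {z. \<forall>a\<in>cone_plane (1 / r) t. a \<bullet> z = 0}"
        by (auto simp: adj AD)
    qed (auto simp: adj AD)
    then show ?thesis using cone_plane_perp[OF r] by simp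
  qed
  have "envelope (range (\<lambda>t. A ` cone_plane r t)) = range (\<lambda>t. A ` cone_pt r (t + pi))"
    unfolding envelope_eq_dual tan perp[symmetric] by blast
  then show ?thesis by (simp add: range_cone_pt_shift[of "(`) A"])
qed

section \<open>Pairs of points at a fixed angle on a circle\<close>

lemma cone_pt_eq_iff:
  assumes "r > 0"
  shows "cone_pt r s = cone_pt r t \<longleftrightarrow> cos s = cos t \<and> sin s = sin t"
proof
  assume "cone_pt r s = cone_pt r t"
  then obtain k where "cone_vec r s = k *\<^sub>R cone_vec r t"
    unfolding cone_pt_def span_singleton_eq_iff[OF cone_vec_nonzero[OF assms]] by blast
  then show "cos s = cos t \<and> sin s = sin t"
    using assms by (simp add: vec_eq_iff forall_3)
qed (simp add: cone_pt_def cone_vec_def)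

lemma cone_pt_periodic: "cone_pt r (t + 2 * pi * of_int k) = cone_pt r t"
  by (simp add: cone_pt_def cone_vec_def cos_add sin_add)

text \<open>Used to rule out the branch \<open>X = Y\<close> in \<open>G_op\<close> and
  \<open>H_op\<close> for a positive angle.\<close>

lemma cone_pt_neq_of_half_angle:
  assumes "r > 0" "0 < h" "h < pi / 2"
  shows "cone_pt r (m - h) \<noteq> cone_pt r (m + h)"
proof
  have "sin h > 0" using assms by (intro sin_gt_zero) auto
  assume "cone_pt r (m - h) = cone_pt r (m + h)"
  then have "sin m * sin h = 0" "cos m * sin h = 0"
    by (simp_all add: cone_pt_eq_iff[OF assms(1)] cos_add sin_add cos_diff sin_diff)
  with \<open>sin h > 0\<close> show False
    using sin_zero_abs_cos_one[of m] by auto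
qed

lemma cone_plane_Int:
  assumes "r > 0" "0 < h" "h < pi / 2"
  shows "cone_plane r (m - h) \<inter> cone_plane r (m + h) = cone_pt (r * cos h) m"
proof (intro equalityI subsetI)
  have "sin h > 0" using assms by (intro sin_gt_zero) auto
  fix v assume v: "v \<in> cone_plane r (m - h) \<inter> cone_plane r (m + h)"
  \<comment> \<open>Components of \<open>v\<close> along and across the bisecting direction
    \<open>m\<close>. The two tangent equations are mirror images in \<open>q\<close>: their
    difference gives \<open>q = 0\<close>, their sum gives the third coordinate.\<close>
  define p q where "p = v $ 1 * cos m + v $ 2 * sin m" and "q = v $ 2 * cos m - v $ 1 * sin m"
  have "r * (p * cos h - q * sin h) = v $ 3" "r * (p * cos h + q * sin h) = v $ 3"
    using v unfolding p_def q_def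
    by (simp_all add: cone_plane_def cos_add sin_add cos_diff sin_diff algebra_simps)
  then have "r * q * sin h = 0" "v $ 3 = p * (r * cos h)"
    by (simp_all add: algebra_simps)
  then have "q = 0" "v $ 3 = p * (r * cos h)"
    using assms \<open>sin h > 0\<close> by auto
  then have "v = p *\<^sub>R cone_vec (r * cos h) m"
    using rotation_inverse[of "v $ 1" m "v $ 2"]
    by (simp add: vec_eq_iff forall_3 flip: p_def q_def)
  then show "v \<in> cone_pt (r * cos h) m"
    by (auto simp: cone_pt_def span_singleton)
next
  fix v assume "v \<in> cone_pt (r * cos h) m"
  then obtain k where k: "v = k *\<^sub>R cone_vec (r * cos h) m"
    by (auto simp: cone_pt_def span_singleton)
  have "r * (k * cos m * cos u + k * sin m * sin u) = k * (r * cos (m - u))" for u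
    by (simp add: cos_diff algebra_simps)
  from this[of "m - h"] this[of "m + h"]
  show "v \<in> cone_plane r (m - h) \<inter> cone_plane r (m + h)"
    by (simp add: cone_plane_def k)
qed

text \<open>Half the sum and half the difference of the two end vectors are \<open>cos h\<close> and
  \<open>sin h\<close> times the vectors that span the tangent at angle \<open>m\<close> of the
  circle with parameter \<open>r / cos h\<close>.\<close>

lemma span_cone_pt_Un:
  assumes "r > 0" "0 < h" "h < pi / 2"
  shows "span (cone_pt r (m - h) \<union> cone_pt r (m + h)) = cone_plane (r / cos h) m"
proof -
  let ?c = "cone_vec (r / cos h) m" and ?n = "vector [- sin m, cos m, 0] :: real^3"
  let ?a = "cone_vec r (m - h)" and ?b = "cone_vec r (m + h)"
  have "sin h > 0" "cos h > 0"
    using assms by (auto intro: sin_gt_zero cos_gt_zero)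
  then have a: "?a = cos h *\<^sub>R ?c - sin h *\<^sub>R ?n" and b: "?b = cos h *\<^sub>R ?c + sin h *\<^sub>R ?n"
    by (simp_all add: vec_eq_iff forall_3 cos_add sin_add cos_diff sin_diff)
  have c: "?c = (1 / (2 * cos h)) *\<^sub>R (?a + ?b)" and n: "?n = (1 / (2 * sin h)) *\<^sub>R (?b - ?a)"
    unfolding a b using \<open>sin h > 0\<close> \<open>cos h > 0\<close> by (simp_all add: vec_eq_iff field_simps)
  have "span (cone_pt r (m - h) \<union> cone_pt r (m + h)) = span {?a, ?b}"
    unfolding cone_pt_def
  proof (rule span_eq[THEN iffD2], intro conjI)
    show "span {?a} \<union> span {?b} \<subseteq> span {?a, ?b}"
      by (intro Un_least span_mono) auto
    show "{?a, ?b} \<subseteq> span (span {?a} \<union> span {?b})"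
      by (auto intro!: span_base)
  qed
  also have "\<dots> = span {?c, ?n}"
  proof (rule span_eq[THEN iffD2], intro conjI)
    show "{?a, ?b} \<subseteq> span {?c, ?n}"
      unfolding a b by (auto intro!: span_add span_diff span_scale intro: span_base)
    show "{?c, ?n} \<subseteq> span {?a, ?b}"
      by (subst c, subst n) (auto intro!: span_add span_diff span_scale intro: span_base)
  qed
  finally show ?thesis by (simp add: cone_plane_eq_span)
qed

section \<open>Linear coordinates adapted to the pencil\<close>

text \<open>
  In coordinates centred at \<open>F\<close>, the pole of the tangent \<open>(x - c) \<bullet> u = R\<close> of the circle of radius
  \<open>R\<close> about \<open>c\<close>, where \<open>u = (cos t, sin t)\<close>, is \<open>(\<rho>\<^sup>2 u, R + (c - F) \<bullet> u)\<close>. This depends linearly on \<open>(u, R)\<close>,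
  and the following is that linear map, independent of \<open>R\<close>.
\<close>

definition pencil_frame :: "real^2 \<Rightarrow> real \<Rightarrow> real^2 \<Rightarrow> real^3 \<Rightarrow> real^3" where
  "pencil_frame F \<rho> c v =
     hom_coords ((v $ 3 + (c - F) \<bullet> xy_part v) *\<^sub>R F + \<rho>\<^sup>2 *\<^sub>R xy_part v) (v $ 3 + (c - F) \<bullet> xy_part v)"

definition pencil_conic :: "real^2 \<Rightarrow> real \<Rightarrow> real^2 \<Rightarrow> real \<Rightarrow> ppoint set" where
  "pencil_conic F \<rho> c R = range (\<lambda>t. pencil_frame F \<rho> c ` cone_pt R t)"

lemma hom_coords_nth [simp]:
  "hom_coords x w $ 1 = x $ 1" "hom_coords x w $ 2 = x $ 2" "hom_coords x w $ 3 = w"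
  by (simp_all add: hom_coords_def)

lemma xy_part_nth [simp]: "xy_part v $ 1 = v $ 1" "xy_part v $ 2 = v $ 2"
  by (simp_all add: xy_part_def)

lemma unit_dir_nth [simp]: "unit_dir t $ 1 = cos t" "unit_dir t $ 2 = sin t"
  by (simp_all add: unit_dir_def)

lemma linear_pencil_frame: "linear (pencil_frame F \<rho> c)"
  by (rule linearI) (simp_all add: pencil_frame_def vec_eq_iff forall_3 inner_vec_def sum_2 algebra_simps)

lemma bij_linear_vec3:
  fixes A :: "real^3 \<Rightarrow> real^3"
  assumes "linear A" "\<And>v. A v = 0 \<Longrightarrow> v = 0"
  shows "bij A"
proof -
  have "inj A" using assms by (simp add: linear_injective_0)
  then show ?thesis
    using linear_injective_imp_surjective[OF assms(1)] by (simp add: bij_def)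
qed

lemma bij_pencil_frame:
  assumes "\<rho> > 0"
  shows "bij (pencil_frame F \<rho> c)"
proof (rule bij_linear_vec3[OF linear_pencil_frame])
  fix v assume "pencil_frame F \<rho> c v = 0"
  then show "v = 0"
    using assms by (auto simp: pencil_frame_def vec_eq_iff forall_3 inner_vec_def sum_2)
qed

section \<open>Polar coordinates at the focus\<close>

lemma linear_image_span_singleton:
  "linear A \<Longrightarrow> A ` span {v :: 'a::real_vector} = span {A v}"
  using linear_span_image[of A "{v}"] by simp

text \<open>The vector from \<open>F\<close> to \<open>c\<close> in polar form supplies the axis
  direction \<open>\<alpha>\<close> and, divided by \<open>R\<close>, the eccentricity. The
  homogeneous vectors on the two sides differ by the factor \<open>R\<close>, which the span
  ignores.\<close>

lemma focal_pt_eq_frame: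
  assumes "R > 0" "c - F = (R * e) *\<^sub>R unit_dir \<alpha>"
  shows "focal_pt F (\<rho>\<^sup>2 / R) e \<alpha> \<phi> = pencil_frame F \<rho> c ` cone_pt R (\<alpha> + \<phi>)"
proof -
  have "cos \<alpha> * cos (\<alpha> + \<phi>) + sin \<alpha> * sin (\<alpha> + \<phi>) = cos \<phi>"
    using cos_diff[of \<alpha> "\<alpha> + \<phi>"] by simp
  then have w: "(c - F) \<bullet> xy_part (cone_vec R (\<alpha> + \<phi>)) = R * e * cos \<phi>"
    unfolding assms(2) by (simp add: inner_vec_def sum_2 mult.assoc flip: distrib_left)
  have "pencil_frame F \<rho> c (cone_vec R (\<alpha> + \<phi>)) = R *\<^sub>R
      hom_coords ((1 + e * cos \<phi>) *\<^sub>R F + (\<rho>\<^sup>2 / R) *\<^sub>R unit_dir (\<alpha> + \<phi>)) (1 + e * cos \<phi>)"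
    unfolding pencil_frame_def w using assms(1) by (simp add: vec_eq_iff forall_3 field_simps)
  then show ?thesis
    using assms(1)
    by (simp add: focal_pt_def cone_pt_def linear_image_span_singleton[OF linear_pencil_frame]
        span_singleton_scaleR)
qed

lemma ex_unit_dir: "\<exists>r \<alpha>. r \<ge> 0 \<and> d = r *\<^sub>R unit_dir \<alpha>"
proof -
  obtain r a where ra: "d $ 1 = r * cos a" "d $ 2 = r * sin a"
    using polar_Ex by blast
  show ?thesis
  proof (cases "r \<ge> 0")
    case True
    then show ?thesis using ra by (intro exI[of _ r] exI[of _ a]) (simp add: vec_eq_iff forall_2)
  next
    \<comment> \<open>A negative radius is made positive by a half turn of the angle.\<close>
    case False
    then show ?thesis
      using ra by (intro exI[of _ "- r"] exI[of _ "a + pi"]) (simp add: vec_eq_iff forall_2)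
  qed
qed

lemma pencil_conic_eq_focal:
  assumes "R > 0" "c - F = (R * e) *\<^sub>R unit_dir \<alpha>"
  shows "pencil_conic F \<rho> c R = range (focal_pt F (\<rho>\<^sup>2 / R) e \<alpha>)"
proof -
  have "focal_pt F (\<rho>\<^sup>2 / R) e \<alpha> = (\<lambda>t. pencil_frame F \<rho> c ` cone_pt R (t + \<alpha>))"
    by (rule ext) (simp only: focal_pt_eq_frame[OF assms] add.commute)
  then show ?thesis
    by (simp only: pencil_conic_def range_cone_pt_shift[of "(`) (pencil_frame F \<rho> c)"])
qed

text \<open>Equal points have proportional homogeneous vectors. The third coordinates let the
  \<open>F\<close> terms cancel, and the lengths of the remaining direction parts determine the
  factor \<open>k\<close> up to sign. Both signs are possible because radii may be negative.\<close>

lemma focal_pt_eq_imp: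
  assumes "l > 0" "l' > 0" "focal_pt F l e \<alpha> \<phi> = focal_pt F l' e' \<alpha>' \<psi>"
  obtains k where "1 + e * cos \<phi> = k * (1 + e' * cos \<psi>)"
    "l * cos (\<alpha> + \<phi>) = k * (l' * cos (\<alpha>' + \<psi>))" "l * sin (\<alpha> + \<phi>) = k * (l' * sin (\<alpha>' + \<psi>))"
    "k = l / l' \<or> k = - (l / l')"
proof -
  let ?v = "hom_coords ((1 + e * cos \<phi>) *\<^sub>R F + l *\<^sub>R unit_dir (\<alpha> + \<phi>)) (1 + e * cos \<phi>)"
  have "?v \<noteq> 0"
    using assms(1) sin_zero_abs_cos_one[of "\<alpha> + \<phi>"] by (auto simp: vec_eq_iff forall_3)
  then obtain k where v: "?v = k *\<^sub>R
      hom_coords ((1 + e' * cos \<psi>) *\<^sub>R F + l' *\<^sub>R unit_dir (\<alpha>' + \<psi>)) (1 + e' * cos \<psi>)"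
    using assms(3) unfolding focal_pt_def by (subst (asm) span_singleton_eq_iff) blast+
  then have w: "1 + e * cos \<phi> = k * (1 + e' * cos \<psi>)"
    by (simp add: vec_eq_iff forall_3)
  have c: "l * cos (\<alpha> + \<phi>) = k * (l' * cos (\<alpha>' + \<psi>))" and s: "l * sin (\<alpha> + \<phi>) = k * (l' * sin (\<alpha>' + \<psi>))"
    using v unfolding w by (simp_all add: vec_eq_iff forall_3) (simp_all add: algebra_simps)
  have "l\<^sup>2 * ((cos (\<alpha> + \<phi>))\<^sup>2 + (sin (\<alpha> + \<phi>))\<^sup>2)
      = (k * l')\<^sup>2 * ((cos (\<alpha>' + \<psi>))\<^sup>2 + (sin (\<alpha>' + \<psi>))\<^sup>2)"
    unfolding distrib_left power_mult_distrib[symmetric] c s by (simp add: mult.assoc)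
  then have "l\<^sup>2 = (k * l')\<^sup>2" by simp
  then have "k * l' = l \<or> k * l' = - l" by (auto simp: power2_eq_iff)
  then have "k = l / l' \<or> k = - (l / l')" using assms(2) by (auto simp: field_simps)
  with that w c s show ?thesis by blast
qed

text \<open>Makes differences of polar angles independent of the chosen parametrisation. Comparing
  points at every direction \<open>t\<close> yields a sinusoid in \<open>t\<close> that takes at
  most two values, which forces it to vanish. The conclusion concerns \<open>e\<close> times the
  axis direction, since the direction alone is arbitrary for a circle centred at
  \<open>F\<close>.\<close>

lemma focal_parameters_unique:
  assumes l: "l > 0" "l' > 0" and sub: "range (focal_pt F l e \<alpha>) \<subseteq> range (focal_pt F l' e' \<alpha>')"
  shows "l = l'" "e *\<^sub>R unit_dir \<alpha> = e' *\<^sub>R unit_dir \<alpha>'"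
proof -
  define m where "m = l / l'"
  have "m > 0" using l by (simp add: m_def)
  \<comment> \<open>The coefficients of \<open>cos t\<close> and \<open>sin t\<close> in
    \<open>e * cos (t - \<alpha>) - m * e' * cos (t - \<alpha>')\<close>.\<close>
  define p q where "p = e * cos \<alpha> - m * e' * cos \<alpha>'" and "q = e * sin \<alpha> - m * e' * sin \<alpha>'"
  have two_values: "p * cos t + q * sin t = m - 1 \<or> p * cos t + q * sin t = - m - 1" for t
  proof -
    obtain \<psi> where "focal_pt F l e \<alpha> (t - \<alpha>) = focal_pt F l' e' \<alpha>' \<psi>"
      using sub by blast
    from focal_pt_eq_imp[OF l this] obtain k where
      w: "1 + e * cos (t - \<alpha>) = k * (1 + e' * cos \<psi>)" and
      cs: "l * cos t = k * (l' * cos (\<alpha>' + \<psi>))" "l * sin t = k * (l' * sin (\<alpha>' + \<psi>))" and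
      k: "k = m \<or> k = - m"
      unfolding m_def by auto
    have "l * cos (t - \<alpha>') = k * l' * cos \<psi>"
    proof -
      have "l * cos (t - \<alpha>') = (l * cos t) * cos \<alpha>' + (l * sin t) * sin \<alpha>'"
        by (simp add: cos_diff algebra_simps)
      also have "\<dots> = k * l' * cos ((\<alpha>' + \<psi>) - \<alpha>')"
        unfolding cs cos_diff[of "\<alpha>' + \<psi>"] by (simp only: algebra_simps)
      finally show ?thesis by simp
    qed
    then have "k * cos \<psi> = m * cos (t - \<alpha>')"
      using l by (simp add: m_def field_simps)
    then have "1 + e * cos (t - \<alpha>) = k + e' * (m * cos (t - \<alpha>'))"
      using w by (simp add: algebra_simps)
    then have "p * cos t + q * sin t = k - 1"
      unfolding p_def q_def by (simp add: cos_diff algebra_simps)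
    then show ?thesis using k by auto
  qed
  obtain s a where s: "s \<ge> 0" and pq: "vector [p, q] = s *\<^sub>R unit_dir a"
    using ex_unit_dir by blast
  have p: "p = s * cos a" and q: "q = s * sin a"
    using pq by (simp_all add: vec_eq_iff forall_2)
  \<comment> \<open>A quarter turn away from its maximum the sinusoid is zero, and
    \<open>- m - 1\<close> is negative.\<close>
  have "m = 1"
    using two_values[of "a + pi / 2"] \<open>m > 0\<close> by (simp add: p q cos_add sin_add)
  \<comment> \<open>At its maximum the sinusoid equals the amplitude \<open>s\<close>. With
    \<open>m = 1\<close> the admissible values are 0 and -2, and \<open>s\<close> is
    nonnegative.\<close>
  have "p * cos a + q * sin a = s * ((cos a)\<^sup>2 + (sin a)\<^sup>2)"
    by (simp only: p q power2_eq_square distrib_left mult.assoc)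
  then have "s = 0"
    using two_values[of a] s \<open>m = 1\<close> by simp
  then show "l = l'" "e *\<^sub>R unit_dir \<alpha> = e' *\<^sub>R unit_dir \<alpha>'"
    using \<open>m = 1\<close> l p q by (simp_all add: m_def p_def q_def vec_eq_iff forall_2)
qed

text \<open>Describes a pair by the angle \<open>m\<close> of its bisector, the form in which
  tangents and chords were computed. Full turns disappear by periodicity.\<close>

lemma focal_angle_pencil_conic:
  fixes F c :: "real^2"
  assumes \<rho>: "\<rho> > 0" and R: "R > 0"
  defines "P \<equiv> \<lambda>t. pencil_frame F \<rho> c ` cone_pt R t"
  shows "focal_angle F (pencil_conic F \<rho> c R) \<theta> X Y \<longleftrightarrow>
    (\<exists>m. X = P (m - \<theta> / 2) \<and> Y = P (m + \<theta> / 2) \<or> X = P (m + \<theta> / 2) \<and> Y = P (m - \<theta> / 2))"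
proof -
  obtain d \<alpha>\<^sub>0 where "d \<ge> 0" and d: "c - F = d *\<^sub>R unit_dir \<alpha>\<^sub>0"
    using ex_unit_dir by blast
  define e\<^sub>0 where "e\<^sub>0 = d / R"
  have e0: "e\<^sub>0 \<ge> 0" "c - F = (R * e\<^sub>0) *\<^sub>R unit_dir \<alpha>\<^sub>0"
    using \<open>d \<ge> 0\<close> d R by (simp_all add: e\<^sub>0_def)
  have l0: "\<rho>\<^sup>2 / R > 0" using \<rho> R by simp
  note conic = pencil_conic_eq_focal[OF R e0(2), of \<rho>]
  have per: "P (t + 2 * pi * of_int k) = P t" for t k
    by (simp add: P_def cone_pt_periodic)
  show ?thesis
  proof
    assume "focal_angle F (pencil_conic F \<rho> c R) \<theta> X Y"
    then obtain l e \<alpha> \<phi> \<psi> k where l: "l > 0" and C: "pencil_conic F \<rho> c R = range (focal_pt F l e \<alpha>)"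
      and X: "X = focal_pt F l e \<alpha> \<phi>" and Y: "Y = focal_pt F l e \<alpha> \<psi>"
      and k: "\<psi> - \<phi> = \<theta> + 2 * pi * of_int k \<or> \<psi> - \<phi> = - \<theta> + 2 * pi * of_int k"
      unfolding focal_angle_def by blast
    have "range (focal_pt F l e \<alpha>) \<subseteq> range (focal_pt F (\<rho>\<^sup>2 / R) e\<^sub>0 \<alpha>\<^sub>0)"
      using C conic by simp
    note uniq = focal_parameters_unique[OF l l0 this]
    \<comment> \<open>Only \<open>e\<close> times the axis direction is known, and this is what
      \<open>focal_pt_eq_frame\<close> asks for; an arbitrary \<open>\<alpha>\<close> in the case
      \<open>e = 0\<close> is thus covered as well.\<close>
    have "c - F = (R * e) *\<^sub>R unit_dir \<alpha>"
      using uniq(2) e0(2) by (simp flip: scaleR_scaleR)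
    note fp = focal_pt_eq_frame[OF R this, of \<rho>]
    have XP: "X = P (\<alpha> + \<phi>)" and YP: "Y = P (\<alpha> + \<psi>)"
      unfolding X Y uniq(1) fp P_def by (rule refl)+
    from k show "\<exists>m. X = P (m - \<theta> / 2) \<and> Y = P (m + \<theta> / 2) \<or> X = P (m + \<theta> / 2) \<and> Y = P (m - \<theta> / 2)"
    proof
      assume "\<psi> - \<phi> = \<theta> + 2 * pi * of_int k"
      then have "\<alpha> + \<psi> = (\<alpha> + \<phi> + \<theta> / 2 + \<theta> / 2) + 2 * pi * of_int k" by simp
      then have "Y = P (\<alpha> + \<phi> + \<theta> / 2 + \<theta> / 2)" unfolding YP by (simp only: per)
      then show ?thesis using XP by (intro exI[of _ "\<alpha> + \<phi> + \<theta> / 2"]) simp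
    next
      assume "\<psi> - \<phi> = - \<theta> + 2 * pi * of_int k"
      then have "\<alpha> + \<psi> = (\<alpha> + \<phi> - \<theta> / 2 - \<theta> / 2) + 2 * pi * of_int k" by simp
      then have "Y = P (\<alpha> + \<phi> - \<theta> / 2 - \<theta> / 2)" unfolding YP by (simp only: per)
      then show ?thesis using XP by (intro exI[of _ "\<alpha> + \<phi> - \<theta> / 2"]) simp
    qed
  next
    note fp = focal_pt_eq_frame[OF R e0(2), of \<rho>]
    have PX: "P t = focal_pt F (\<rho>\<^sup>2 / R) e\<^sub>0 \<alpha>\<^sub>0 (t - \<alpha>\<^sub>0)" for t
      by (simp add: fp P_def)
    assume "\<exists>m. X = P (m - \<theta> / 2) \<and> Y = P (m + \<theta> / 2) \<or> X = P (m + \<theta> / 2) \<and> Y = P (m - \<theta> / 2)"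
    then obtain s t where XY: "X = P s" "Y = P t" and st: "t - s = \<theta> \<or> t - s = - \<theta>"
    proof (elim exE disjE conjE)
      fix m assume "X = P (m - \<theta> / 2)" "Y = P (m + \<theta> / 2)"
      then show ?thesis by (rule that) simp
    next
      fix m assume "X = P (m + \<theta> / 2)" "Y = P (m - \<theta> / 2)"
      then show ?thesis by (rule that) simp
    qed
    have "\<exists>k::int. (t - \<alpha>\<^sub>0) - (s - \<alpha>\<^sub>0) = \<theta> + 2 * pi * of_int k \<or>
        (t - \<alpha>\<^sub>0) - (s - \<alpha>\<^sub>0) = - \<theta> + 2 * pi * of_int k"
      using st by (intro exI[of _ 0]) simp
    then show "focal_angle F (pencil_conic F \<rho> c R) \<theta> X Y"
      unfolding focal_angle_def XY PX using l0 e0(1) conic by blast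
  qed
qed

section \<open>The two operations on conics of the pencil\<close>

lemma tangent_at_pencil_conic:
  assumes "\<rho> > 0" "R > 0"
  shows "tangent_at (pencil_conic F \<rho> c R) (pencil_frame F \<rho> c ` cone_pt R t) L \<longleftrightarrow>
    L = pencil_frame F \<rho> c ` cone_plane R t"
proof -
  have inj: "inj (pencil_frame F \<rho> c)" using bij_pencil_frame[OF assms(1)] by (rule bij_is_inj)
  have conic: "pencil_conic F \<rho> c R = (`) (pencil_frame F \<rho> c) ` range (cone_pt R)"
    by (simp add: pencil_conic_def image_image)
  \<comment> \<open>The point determines sine and cosine of its angle, hence the tangent there is
    unique.\<close>
  have plane: "cone_plane R s = cone_plane R t" if "cone_pt R t = cone_pt R s" for s
    using that assms(2) by (simp add: cone_pt_eq_iff cone_plane_def)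
  have "tangent_at (pencil_conic F \<rho> c R) (pencil_frame F \<rho> c ` cone_pt R t) L \<longleftrightarrow>
      (\<exists>X' L'. cone_pt R t = X' \<and> L = pencil_frame F \<rho> c ` L' \<and>
        (\<exists>s. X' = cone_pt R s \<and> L' = cone_plane R s))"
    unfolding conic tangent_at_image_iff[OF linear_pencil_frame bij_pencil_frame[OF assms(1)]]
      tangent_at_cone[OF assms(2)] inj_image_eq_iff[OF inj] by (rule refl)
  also have "\<dots> \<longleftrightarrow> L = pencil_frame F \<rho> c ` cone_plane R t"
    using plane by metis
  finally show ?thesis .
qed

text \<open>Each bisector angle \<open>m\<close> contributes the point at angle \<open>m\<close> of
  the conic with parameter \<open>R * cos (\<theta> / 2)\<close>, by \<open>cone_plane_Int\<close>
  carried over by the frame. The angle zero is separate because the two points then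
  coincide.\<close>

lemma G_op_pencil_conic:
  assumes \<rho>: "\<rho> > 0" and R: "R > 0" and \<theta>: "0 \<le> \<theta>" "\<theta> < pi"
  shows "G_op F \<theta> (pencil_conic F \<rho> c R) = pencil_conic F \<rho> c (R * cos (\<theta> / 2))"
proof -
  let ?A = "pencil_frame F \<rho> c"
  have inj: "inj ?A" using bij_pencil_frame[OF \<rho>] by (rule bij_is_inj)
  note fa = focal_angle_pencil_conic[OF \<rho> R, of F c]
  show ?thesis
  proof (cases "\<theta> = 0")
    case True
    then show ?thesis
      unfolding G_op_def fa by (auto simp: pencil_conic_def)
  next
    case False
    then have h: "0 < \<theta> / 2" "\<theta> / 2 < pi / 2" using \<theta> by auto
    note tan = tangent_at_pencil_conic[OF \<rho> R, of F c]
    have neq: "?A ` cone_pt R (m - \<theta> / 2) \<noteq> ?A ` cone_pt R (m + \<theta> / 2)" for m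
      using cone_pt_neq_of_half_angle[OF R h] inj by (simp add: inj_image_eq_iff)
    have int: "?A ` cone_plane R (m - \<theta> / 2) \<inter> ?A ` cone_plane R (m + \<theta> / 2)
        = ?A ` cone_pt (R * cos (\<theta> / 2)) m" for m
      unfolding cone_plane_Int[OF R h, symmetric] using inj by (simp add: image_Int)
    show ?thesis
    proof (intro equalityI subsetI)
      fix Z assume "Z \<in> G_op F \<theta> (pencil_conic F \<rho> c R)"
      then obtain X Y m where Z: "if X = Y then Z = X
          else \<exists>L M. tangent_at (pencil_conic F \<rho> c R) X L \<and> tangent_at (pencil_conic F \<rho> c R) Y M \<and> Z = L \<inter> M"
        and XY: "X = ?A ` cone_pt R (m - \<theta> / 2) \<and> Y = ?A ` cone_pt R (m + \<theta> / 2) \<or>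
          X = ?A ` cone_pt R (m + \<theta> / 2) \<and> Y = ?A ` cone_pt R (m - \<theta> / 2)"
        unfolding G_op_def fa by blast
      from XY have "Z = ?A ` cone_pt (R * cos (\<theta> / 2)) m"
        using Z neq[of m] int[of m] by (elim disjE conjE) (simp_all add: tan Int_commute)
      then show "Z \<in> pencil_conic F \<rho> c (R * cos (\<theta> / 2))"
        by (simp add: pencil_conic_def)
    next
      fix Z assume "Z \<in> pencil_conic F \<rho> c (R * cos (\<theta> / 2))"
      then obtain m where Z: "Z = ?A ` cone_pt (R * cos (\<theta> / 2)) m"
        by (auto simp: pencil_conic_def)
      show "Z \<in> G_op F \<theta> (pencil_conic F \<rho> c R)"
        unfolding G_op_def mem_Collect_eq
      proof (intro exI conjI)
        let ?X = "?A ` cone_pt R (m - \<theta> / 2)" and ?Y = "?A ` cone_pt R (m + \<theta> / 2)"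
        show "focal_angle F (pencil_conic F \<rho> c R) \<theta> ?X ?Y"
          unfolding fa by blast
        show "if ?X = ?Y then Z = ?X
          else \<exists>L M. tangent_at (pencil_conic F \<rho> c R) ?X L \<and> tangent_at (pencil_conic F \<rho> c R) ?Y M \<and> Z = L \<inter> M"
          by (simp add: neq tan int Z)
      qed
    qed
  qed
qed

text \<open>The chords, and for angle zero the tangents, are exactly the tangent lines of the conic
  with parameter \<open>R / cos (\<theta> / 2)\<close>, so their envelope is that conic.\<close>

lemma H_op_pencil_conic:
  assumes \<rho>: "\<rho> > 0" and R: "R > 0" and \<theta>: "0 \<le> \<theta>" "\<theta> < pi"
  shows "H_op F \<theta> (pencil_conic F \<rho> c R) = pencil_conic F \<rho> c (R / cos (\<theta> / 2))"
proof -
  let ?A = "pencil_frame F \<rho> c"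
  note A = linear_pencil_frame[of F \<rho> c] bij_pencil_frame[OF \<rho>, of F c]
  have inj: "inj ?A" using A(2) by (rule bij_is_inj)
  have k: "cos (\<theta> / 2) > 0" using \<theta> by (intro cos_gt_zero_pi) auto
  note fa = focal_angle_pencil_conic[OF \<rho> R, of F c]
  note tan = tangent_at_pencil_conic[OF \<rho> R, of F c]
  have line: "(if ?A ` cone_pt R (m - \<theta> / 2) = ?A ` cone_pt R (m + \<theta> / 2)
         then tangent_at (pencil_conic F \<rho> c R) (?A ` cone_pt R (m - \<theta> / 2)) L
         else L = span (?A ` cone_pt R (m - \<theta> / 2) \<union> ?A ` cone_pt R (m + \<theta> / 2))) \<longleftrightarrow>
       L = ?A ` cone_plane (R / cos (\<theta> / 2)) m" for m L
  proof (cases "\<theta> = 0")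
    case True
    then show ?thesis by (simp add: tan)
  next
    case False
    then have h: "0 < \<theta> / 2" "\<theta> / 2 < pi / 2" using \<theta> by auto
    have "?A ` cone_pt R (m - \<theta> / 2) \<noteq> ?A ` cone_pt R (m + \<theta> / 2)"
      using cone_pt_neq_of_half_angle[OF R h] inj by (simp add: inj_image_eq_iff)
    moreover have "span (?A ` cone_pt R (m - \<theta> / 2) \<union> ?A ` cone_pt R (m + \<theta> / 2))
        = ?A ` cone_plane (R / cos (\<theta> / 2)) m"
      unfolding span_cone_pt_Un[OF R h, symmetric] image_Un[symmetric] by (rule linear_span_image[OF A(1)])
    ultimately show ?thesis by simp
  qed
  have "{L. \<exists>X Y. focal_angle F (pencil_conic F \<rho> c R) \<theta> X Y \<and>
        (if X = Y then tangent_at (pencil_conic F \<rho> c R) X L else L = span (X \<union> Y))}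
      = range (\<lambda>m. ?A ` cone_plane (R / cos (\<theta> / 2)) m)" (is "?L = ?R")
  proof (intro equalityI subsetI)
    fix L assume "L \<in> ?L"
    then obtain X Y m where L: "if X = Y then tangent_at (pencil_conic F \<rho> c R) X L else L = span (X \<union> Y)"
      and XY: "X = ?A ` cone_pt R (m - \<theta> / 2) \<and> Y = ?A ` cone_pt R (m + \<theta> / 2) \<or>
        X = ?A ` cone_pt R (m + \<theta> / 2) \<and> Y = ?A ` cone_pt R (m - \<theta> / 2)"
      unfolding fa by blast
    \<comment> \<open>The condition on \<open>L\<close> is symmetric in \<open>X\<close> and
      \<open>Y\<close>, so either order of the pair reduces to \<open>line\<close>.\<close>
    from L have "if Y = X then tangent_at (pencil_conic F \<rho> c R) Y L else L = span (Y \<union> X)"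
      by (auto simp: Un_commute split: if_splits)
    with XY L have "L = ?A ` cone_plane (R / cos (\<theta> / 2)) m"
      unfolding line[symmetric] by (elim disjE conjE) (hypsubst, assumption)+
    then show "L \<in> ?R" by blast
  next
    fix L assume "L \<in> ?R"
    then obtain m where m: "L = ?A ` cone_plane (R / cos (\<theta> / 2)) m" by blast
    have "focal_angle F (pencil_conic F \<rho> c R) \<theta> (?A ` cone_pt R (m - \<theta> / 2)) (?A ` cone_pt R (m + \<theta> / 2))"
      unfolding fa by blast
    then show "L \<in> ?L" using line[of m L, THEN iffD2, OF m] by blast
  qed
  then have "H_op F \<theta> (pencil_conic F \<rho> c R) = envelope ?R"
    by (simp only: H_op_def)
  also have "\<dots> = pencil_conic F \<rho> c (R / cos (\<theta> / 2))"
    unfolding pencil_conic_def using R k by (intro envelope_cone_planes[OF A]) simp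
  finally show ?thesis .
qed

section \<open>Reciprocals of the circles about \<open>c\<close>\<close>

definition circle_frame :: "real^2 \<Rightarrow> real^3 \<Rightarrow> real^3" where
  "circle_frame c v = hom_coords (xy_part v + (v $ 3) *\<^sub>R c) (v $ 3)"

lemma linear_circle_frame: "linear (circle_frame c)"
  by (rule linearI) (simp_all add: circle_frame_def vec_eq_iff forall_3 algebra_simps)

lemma bij_circle_frame: "bij (circle_frame c)"
proof (rule bij_linear_vec3[OF linear_circle_frame])
  fix v assume "circle_frame c v = 0"
  then show "v = 0"
    by (auto simp: circle_frame_def vec_eq_iff forall_3)
qed

lemma norm_unit_dir: "norm (unit_dir t) = 1"
  by (simp add: norm_eq_sqrt_inner inner_vec_def sum_2 flip: power2_eq_square)

lemma sphere_eq_range: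
  assumes "R > 0"
  shows "sphere c R = range (\<lambda>t. c + R *\<^sub>R unit_dir t)"
proof (intro equalityI subsetI)
  fix x assume x: "x \<in> sphere c R"
  obtain r a where "r \<ge> 0" and r: "x - c = r *\<^sub>R unit_dir a"
    using ex_unit_dir by blast
  moreover have "norm (x - c) = R"
    using x by (simp add: dist_norm norm_minus_commute)
  ultimately have "r = R"
    by (simp add: norm_unit_dir)
  with r show "x \<in> range (\<lambda>t. c + R *\<^sub>R unit_dir t)"
    by (auto simp: algebra_simps)
qed (use assms in \<open>auto simp: dist_norm norm_unit_dir\<close>)

text \<open>The vector \<open>(cos t, sin t, 1 / R)\<close> represents the point of the circle of
  radius \<open>R\<close> about the origin, and \<open>circle_frame c\<close> is the translation by
  \<open>c\<close> in homogeneous coordinates.\<close>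

lemma affine_circle_eq_cone:
  assumes "R > 0"
  shows "affine_pt ` sphere c R = (`) (circle_frame c) ` range (cone_pt (1 / R))"
proof -
  have "affine_pt (c + R *\<^sub>R unit_dir t) = circle_frame c ` cone_pt (1 / R) t" for t
  proof -
    have "circle_frame c (cone_vec (1 / R) t) = (1 / R) *\<^sub>R hom_coords (c + R *\<^sub>R unit_dir t) 1"
      using assms by (simp add: circle_frame_def vec_eq_iff forall_3 field_simps)
    then show ?thesis
      using assms by (simp add: affine_pt_def cone_pt_def span_singleton_scaleR
          linear_image_span_singleton[OF linear_circle_frame])
  qed
  then show ?thesis
    by (simp add: sphere_eq_range[OF assms] image_image)
qed

text \<open>Computes the pole of a tangent. The tangent is spanned by its point at infinity and its
  point of contact; conjugacy with the first fixes the direction of the pole from \<open>F\<close>,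
  conjugacy with the second fixes its weight. The reverse inclusion is checked for all points of the
  tangent.\<close>

lemma polarity_circle_tangent:
  assumes \<rho>: "\<rho> > 0" and R: "R > 0"
  shows "polarity F \<rho> (circle_frame c ` cone_plane (1 / R) t) = pencil_frame F \<rho> c ` cone_pt R t"
proof (intro equalityI subsetI)
  fix v assume "v \<in> polarity F \<rho> (circle_frame c ` cone_plane (1 / R) t)"
  then have pol: "(xy_part (circle_frame c z) - (circle_frame c z $ 3) *\<^sub>R F) \<bullet> (xy_part v - (v $ 3) *\<^sub>R F)
      = \<rho>\<^sup>2 * (circle_frame c z $ 3) * (v $ 3)" if "z \<in> cone_plane (1 / R) t" for z
    using that by (auto simp: polarity_def)
  define x y where "x = v $ 1 - v $ 3 * F $ 1" and "y = v $ 2 - v $ 3 * F $ 2"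
  define k where "k = x * cos t + y * sin t"
  define d where "d = (c - F) \<bullet> unit_dir t"
  have mem: "cone_vec (1 / R) t \<in> cone_plane (1 / R) t" "vector [- sin t, cos t, 0] \<in> cone_plane (1 / R) t"
    unfolding cone_plane_eq_span by (auto intro: span_base)
  \<comment> \<open>The point at infinity of the tangent: the pole lies in the direction normal to
    the tangent as seen from \<open>F\<close>.\<close>
  have "y * cos t - x * sin t = 0"
    using pol[OF mem(2)] by (simp add: circle_frame_def inner_vec_def sum_2 x_def y_def algebra_simps)
  then have x: "x = k * cos t" and y: "y = k * sin t"
    using rotation_inverse[of x t y] by (simp_all add: k_def)
  \<comment> \<open>The point of contact, scaled to have third coordinate
    \<open>1 / R\<close>.\<close>
  have "(cos t + (c $ 1 - F $ 1) / R) * x + (sin t + (c $ 2 - F $ 2) / R) * y = \<rho>\<^sup>2 * v $ 3 / R"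
    using pol[OF mem(1)]
    by (simp add: circle_frame_def inner_vec_def sum_2 x_def y_def diff_divide_distrib algebra_simps)
  then have "R * ((cos t + (c $ 1 - F $ 1) / R) * x + (sin t + (c $ 2 - F $ 2) / R) * y) = \<rho>\<^sup>2 * v $ 3"
    using R by simp
  moreover have "R * ((cos t + (c $ 1 - F $ 1) / R) * x + (sin t + (c $ 2 - F $ 2) / R) * y)
      = R * (x * cos t + y * sin t) + ((c $ 1 - F $ 1) * x + (c $ 2 - F $ 2) * y)"
    using R by (simp add: field_simps)
  ultimately have "R * (x * cos t + y * sin t) + ((c $ 1 - F $ 1) * x + (c $ 2 - F $ 2) * y) = \<rho>\<^sup>2 * v $ 3"
    by simp
  then have "k * (R + d) = \<rho>\<^sup>2 * v $ 3"
    unfolding k_def[symmetric] by (simp add: x y d_def inner_vec_def sum_2 algebra_simps)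
  then have v3: "v $ 3 = k / \<rho>\<^sup>2 * (R + d)"
    using \<rho> by (simp add: field_simps)
  have "v = (k / \<rho>\<^sup>2) *\<^sub>R pencil_frame F \<rho> c (cone_vec R t)"
  proof -
    have xy: "xy_part (cone_vec R t) = unit_dir t"
      by (simp add: vec_eq_iff forall_2)
    have "v $ 1 = v $ 3 * F $ 1 + k * cos t" "v $ 2 = v $ 3 * F $ 2 + k * sin t"
      using x y by (simp_all add: x_def y_def)
    then show ?thesis
      using \<rho> unfolding v3 pencil_frame_def xy d_def[symmetric]
      by (simp add: vec_eq_iff forall_3 v3 field_simps)
  qed
  then show "v \<in> pencil_frame F \<rho> c ` cone_pt R t"
    unfolding cone_pt_def linear_image_span_singleton[OF linear_pencil_frame]
    by (auto simp: span_singleton)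
next
  fix v assume "v \<in> pencil_frame F \<rho> c ` cone_pt R t"
  then obtain k where k: "v = k *\<^sub>R pencil_frame F \<rho> c (cone_vec R t)"
    unfolding cone_pt_def linear_image_span_singleton[OF linear_pencil_frame]
    by (auto simp: span_singleton)
  have "(xy_part (circle_frame c z) - (circle_frame c z $ 3) *\<^sub>R F) \<bullet> (xy_part v - (v $ 3) *\<^sub>R F)
      = \<rho>\<^sup>2 * (circle_frame c z $ 3) * (v $ 3)" if z: "z \<in> cone_plane (1 / R) t" for z
  proof -
    have z: "z $ 1 * cos t + z $ 2 * sin t = R * z $ 3"
      using z R by (simp add: cone_plane_def field_simps)
    have 1: "xy_part (circle_frame c z) - (circle_frame c z $ 3) *\<^sub>R F = xy_part z + (z $ 3) *\<^sub>R (c - F)"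
      by (simp add: circle_frame_def vec_eq_iff forall_2 algebra_simps)
    have 2: "xy_part v - (v $ 3) *\<^sub>R F = (k * \<rho>\<^sup>2) *\<^sub>R unit_dir t"
      by (simp add: k pencil_frame_def vec_eq_iff forall_2 algebra_simps)
    have 3: "v $ 3 = k * (R + (c - F) \<bullet> unit_dir t)"
      by (simp add: k pencil_frame_def inner_vec_def sum_2)
    have 4: "xy_part z \<bullet> unit_dir t = R * z $ 3"
      using z by (simp add: inner_vec_def sum_2)
    have 5: "circle_frame c z $ 3 = z $ 3"
      by (simp add: circle_frame_def)
    show ?thesis
      unfolding 1 2 unfolding 3 5
      by (simp only: inner_add_left inner_scaleR_left inner_scaleR_right 4) (simp add: algebra_simps)
  qed
  then show "v \<in> polarity F \<rho> (circle_frame c ` cone_plane (1 / R) t)"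
    by (simp add: polarity_def)
qed

lemma reciprocal_circle:
  assumes "\<rho> > 0" "R > 0"
  shows "reciprocal F \<rho> (affine_pt ` sphere c R) = pencil_conic F \<rho> c R"
proof -
  have "1 / R > 0" using assms(2) by simp
  note tan = tangent_at_image_iff[OF linear_circle_frame bij_circle_frame] tangent_at_cone[OF this]
  have "reciprocal F \<rho> (affine_pt ` sphere c R)
      = range (\<lambda>t. polarity F \<rho> (circle_frame c ` cone_plane (1 / R) t))"
    unfolding reciprocal_def affine_circle_eq_cone[OF assms(2)] tan by blast
  then show ?thesis
    by (simp only: pencil_conic_def polarity_circle_tangent[OF assms])
qed

lemma focal_pencil_eq:
  assumes "\<rho> > 0"
  shows "focal_pencil F \<rho> c = pencil_conic F \<rho> c ` {0<..}"
proof -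
  have "circles_at c = (\<lambda>R. affine_pt ` sphere c R) ` {0<..}"
    by (auto simp: circles_at_def)
  then show ?thesis
    unfolding focal_pencil_def by (simp add: image_image reciprocal_circle[OF assms])
qed

section \<open>The group of scalings of the pencil\<close>

lemma half_angle_cos_pos:
  assumes "\<theta> \<in> {0..<pi}"
  shows "cos (\<theta> / 2) > 0"
  using assms by (intro cos_gt_zero_pi) auto

text \<open>Every factor in \<open>(0, 1]\<close> is the cosine of half an admissible angle.\<close>

lemma double_arccos:
  assumes "0 < k" "k \<le> 1"
  shows "2 * arccos k \<in> {0..<pi}" "cos (2 * arccos k / 2) = k"
proof -
  have "arccos k < arccos 0" using assms by (intro arccos_less_arccos) auto
  moreover have "0 \<le> arccos k" using assms by (intro arccos_lbound) auto
  ultimately show "2 * arccos k \<in> {0..<pi}" by simp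
  show "cos (2 * arccos k / 2) = k" using assms by simp
qed

text \<open>A predicate on maps: existence for a given positive factor comes from the
  \<open>G\<close> and \<open>H\<close> maps, and uniqueness from extensionality outside the pencil.
  Identities between operations thus become identities between factors.\<close>

definition pencil_scaling :: "real^2 \<Rightarrow> real \<Rightarrow> real^2 \<Rightarrow> real \<Rightarrow> (ppoint set \<Rightarrow> ppoint set) \<Rightarrow> bool" where
  "pencil_scaling F \<rho> c k f \<longleftrightarrow> f \<in> extensional (focal_pencil F \<rho> c) \<and>
     (\<forall>R>0. f (pencil_conic F \<rho> c R) = pencil_conic F \<rho> c (k * R))"

context
  fixes F c :: "real^2" and \<rho> :: real
  assumes \<rho>: "\<rho> > 0"
begin

lemma pencil_conic_mem: "R > 0 \<Longrightarrow> pencil_conic F \<rho> c R \<in> focal_pencil F \<rho> c"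
  by (simp add: focal_pencil_eq[OF \<rho>])

lemma pencil_scaling_unique:
  assumes f: "pencil_scaling F \<rho> c k f" and g: "pencil_scaling F \<rho> c k g"
  shows "f = g"
proof (rule extensionalityI)
  show "f \<in> extensional (focal_pencil F \<rho> c)" "g \<in> extensional (focal_pencil F \<rho> c)"
    using f g by (auto simp: pencil_scaling_def)
  fix C assume "C \<in> focal_pencil F \<rho> c"
  then obtain R where "R > 0" "C = pencil_conic F \<rho> c R"
    by (auto simp: focal_pencil_eq[OF \<rho>])
  then show "f C = g C" using f g by (simp add: pencil_scaling_def)
qed

lemma pencil_scaling_compose:
  assumes f: "pencil_scaling F \<rho> c j f" and g: "pencil_scaling F \<rho> c k g" and k: "k > 0"
  shows "pencil_scaling F \<rho> c (j * k) (compose (focal_pencil F \<rho> c) f g)"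
  using assms by (auto simp: pencil_scaling_def compose_eq pencil_conic_mem mult.assoc)

lemma pencil_scaling_id: "pencil_scaling F \<rho> c 1 (restrict id (focal_pencil F \<rho> c))"
  by (auto simp: pencil_scaling_def pencil_conic_mem)

lemma G_map_scaling:
  assumes "\<theta> \<in> {0..<pi}"
  shows "pencil_scaling F \<rho> c (cos (\<theta> / 2)) (G_map F \<rho> c \<theta>)"
  using assms by (auto simp: pencil_scaling_def G_map_def pencil_conic_mem G_op_pencil_conic[OF \<rho>] mult.commute)

lemma H_map_scaling:
  assumes "\<theta> \<in> {0..<pi}"
  shows "pencil_scaling F \<rho> c (1 / cos (\<theta> / 2)) (H_map F \<rho> c \<theta>)"
  using assms by (auto simp: pencil_scaling_def H_map_def pencil_conic_mem H_op_pencil_conic[OF \<rho>])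

text \<open>The factors of the \<open>G\<close> maps fill \<open>(0, 1]\<close> and those of the
  \<open>H\<close> maps fill \<open>[1, \<infinity>)\<close>. Together they are all positive reals,
  which is why the carrier is closed under composition.\<close>

lemma carrier_pencil_ops:
  "carrier (pencil_ops F \<rho> c) = {f. \<exists>k>0. pencil_scaling F \<rho> c k f}"
proof (intro equalityI subsetI)
  fix f assume "f \<in> carrier (pencil_ops F \<rho> c)"
  then obtain \<theta> where \<theta>: "\<theta> \<in> {0..<pi}" and "f = G_map F \<rho> c \<theta> \<or> f = H_map F \<rho> c \<theta>"
    by (auto simp: pencil_ops_def)
  then consider "f = G_map F \<rho> c \<theta>" | "f = H_map F \<rho> c \<theta>" by blast
  then show "f \<in> {f. \<exists>k>0. pencil_scaling F \<rho> c k f}"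
  proof cases
    case 1
    then show ?thesis using G_map_scaling[OF \<theta>] half_angle_cos_pos[OF \<theta>] by blast
  next
    case 2
    moreover have "1 / cos (\<theta> / 2) > 0" using half_angle_cos_pos[OF \<theta>] by simp
    ultimately show ?thesis using H_map_scaling[OF \<theta>] by blast
  qed
next
  fix f assume "f \<in> {f. \<exists>k>0. pencil_scaling F \<rho> c k f}"
  then obtain k where k: "k > 0" and f: "pencil_scaling F \<rho> c k f" by blast
  show "f \<in> carrier (pencil_ops F \<rho> c)"
  proof (cases "k \<le> 1")
    case True
    note a = double_arccos[OF k True]
    have "f = G_map F \<rho> c (2 * arccos k)"
      using pencil_scaling_unique[OF f] G_map_scaling[OF a(1)] a(2) by simp
    with a(1) show ?thesis by (auto simp: pencil_ops_def)
  next
    case False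
    then have "0 < 1 / k" "1 / k \<le> 1" by auto
    note a = double_arccos[OF this]
    have "f = H_map F \<rho> c (2 * arccos (1 / k))"
      using pencil_scaling_unique[OF f] H_map_scaling[OF a(1)] a(2) by simp
    with a(1) show ?thesis by (auto simp: pencil_ops_def)
  qed
qed

lemma mult_pencil_ops: "f \<otimes>\<^bsub>pencil_ops F \<rho> c\<^esub> g = compose (focal_pencil F \<rho> c) f g"
  and one_pencil_ops: "\<one>\<^bsub>pencil_ops F \<rho> c\<^esub> = restrict id (focal_pencil F \<rho> c)"
  by (simp_all add: pencil_ops_def)

text \<open>Each axiom compares the factors of both sides and applies
  \<open>pencil_scaling_unique\<close>, transferring the laws of multiplication of positive
  reals.\<close>

lemma comm_group_pencil_ops: "comm_group (pencil_ops F \<rho> c)"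
proof (rule comm_groupI, unfold carrier_pencil_ops mult_pencil_ops one_pencil_ops mem_Collect_eq)
  let ?P = "focal_pencil F \<rho> c"
  show "\<exists>k>0. pencil_scaling F \<rho> c k (restrict id ?P)"
    using pencil_scaling_id zero_less_one by blast
  fix f assume "\<exists>k>0. pencil_scaling F \<rho> c k f"
  then obtain j where j: "j > 0" "pencil_scaling F \<rho> c j f" by blast
  show "compose ?P (restrict id ?P) f = f"
    using pencil_scaling_unique[OF pencil_scaling_compose[OF pencil_scaling_id j(2,1)]] j(2) by simp
  have "1 / j > 0" using j by simp
  \<comment> \<open>An explicit scaling by \<open>1 / j\<close>: a \<open>G\<close> map when this
    factor is at most 1, otherwise an \<open>H\<close> map.\<close>
  then have "(if 1 / j \<le> 1 then G_map F \<rho> c (2 * arccos (1 / j)) else H_map F \<rho> c (2 * arccos j))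
      \<in> {f. pencil_scaling F \<rho> c (1 / j) f}"
    using G_map_scaling[OF double_arccos(1), of "1 / j"] H_map_scaling[OF double_arccos(1), of j]
      double_arccos(2)[of "1 / j"] double_arccos(2)[of j] j
    by (auto simp: field_simps)
  then obtain g where g: "pencil_scaling F \<rho> c (1 / j) g" by blast
  have "compose ?P g f = restrict id ?P"
    using pencil_scaling_unique[OF pencil_scaling_compose[OF g j(2,1)]] pencil_scaling_id j(1) by simp
  with g \<open>1 / j > 0\<close> show "\<exists>g\<in>{f. \<exists>k>0. pencil_scaling F \<rho> c k f}. compose ?P g f = restrict id ?P"
    by blast
  fix g assume "\<exists>k>0. pencil_scaling F \<rho> c k g"
  then obtain k where k: "k > 0" "pencil_scaling F \<rho> c k g" by blast
  note fg = pencil_scaling_compose[OF j(2) k(2,1)]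
  from fg mult_pos_pos[OF j(1) k(1)] show "\<exists>k>0. pencil_scaling F \<rho> c k (compose ?P f g)" by blast
  show "compose ?P f g = compose ?P g f"
    using pencil_scaling_unique[OF fg] pencil_scaling_compose[OF k(2) j(2,1)] by (simp add: mult.commute)
  fix h assume "\<exists>k>0. pencil_scaling F \<rho> c k h"
  then obtain i where i: "i > 0" "pencil_scaling F \<rho> c i h" by blast
  show "compose ?P (compose ?P f g) h = compose ?P f (compose ?P g h)"
    using pencil_scaling_unique[OF pencil_scaling_compose[OF fg i(2,1)]]
      pencil_scaling_compose[OF j(2) pencil_scaling_compose[OF k(2) i(2,1)]] i(1) k(1)
    by (simp add: mult.assoc)
qed

text \<open>The factors \<open>cos (\<theta> / 2)\<close> and \<open>1 / cos (\<theta> / 2)\<close>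
  multiply to 1.\<close>

lemma inv_H_map:
  assumes \<theta>: "\<theta> \<in> {0..<pi}"
  shows "G_map F \<rho> c \<theta> = inv\<^bsub>pencil_ops F \<rho> c\<^esub> (H_map F \<rho> c \<theta>)"
proof -
  interpret comm_group "pencil_ops F \<rho> c" by (rule comm_group_pencil_ops)
  note k = half_angle_cos_pos[OF \<theta>]
  have "compose (focal_pencil F \<rho> c) (G_map F \<rho> c \<theta>) (H_map F \<rho> c \<theta>) = restrict id (focal_pencil F \<rho> c)"
    using pencil_scaling_unique[OF pencil_scaling_compose[OF G_map_scaling[OF \<theta>] H_map_scaling[OF \<theta>]]]
      pencil_scaling_id k by simp
  then show ?thesis
    using \<theta> by (intro inv_equality[symmetric]) (auto simp: mult_pencil_ops one_pencil_ops, auto simp: pencil_ops_def)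
qed

text \<open>The product of the two cosines lies again in \<open>(0, 1]\<close>, so it is the factor
  of the \<open>G\<close> map at twice its arc cosine.\<close>

lemma G_map_compose:
  assumes \<theta>: "\<theta> \<in> {0..<pi}" and \<phi>: "\<phi> \<in> {0..<pi}"
  shows "G_map F \<rho> c \<theta> \<otimes>\<^bsub>pencil_ops F \<rho> c\<^esub> G_map F \<rho> c \<phi> =
    G_map F \<rho> c (2 * arccos (cos (\<theta> / 2) * cos (\<phi> / 2)))"
proof -
  note k = half_angle_cos_pos[OF \<theta>] half_angle_cos_pos[OF \<phi>]
  have "cos (\<theta> / 2) * cos (\<phi> / 2) \<le> 1"
    using k by (intro mult_le_one) auto
  note a = double_arccos[OF mult_pos_pos[OF k] this]
  show ?thesis
    unfolding mult_pencil_ops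
    using pencil_scaling_unique[OF pencil_scaling_compose[OF G_map_scaling[OF \<theta>] G_map_scaling[OF \<phi>] k(2)]]
      G_map_scaling[OF a(1)] a(2) by simp
qed

end

theorem theorem9:
  fixes F c :: "real^2" and \<rho> :: real
  assumes "\<rho> > 0"
  shows "(\<forall>\<theta>\<in>{0..<pi}.
            G_op F \<theta> \<in> focal_pencil F \<rho> c \<rightarrow> focal_pencil F \<rho> c \<and>
            H_op F \<theta> \<in> focal_pencil F \<rho> c \<rightarrow> focal_pencil F \<rho> c) \<and>
         comm_group (pencil_ops F \<rho> c) \<and>
         (\<forall>\<theta>\<in>{0..<pi}. G_map F \<rho> c \<theta> = inv\<^bsub>pencil_ops F \<rho> c\<^esub> (H_map F \<rho> c \<theta>)) \<and>
         (\<forall>\<theta>\<in>{0..<pi}. \<forall>\<phi>\<in>{0..<pi}.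
            G_map F \<rho> c \<theta> \<otimes>\<^bsub>pencil_ops F \<rho> c\<^esub> G_map F \<rho> c \<phi> =
            G_map F \<rho> c (2 * arccos (cos (\<theta> / 2) * cos (\<phi> / 2))))"
proof (intro conjI ballI)
  fix \<theta> :: real assume \<theta>: "\<theta> \<in> {0..<pi}"
  note k = half_angle_cos_pos[OF \<theta>]
  show "G_op F \<theta> \<in> focal_pencil F \<rho> c \<rightarrow> focal_pencil F \<rho> c"
    "H_op F \<theta> \<in> focal_pencil F \<rho> c \<rightarrow> focal_pencil F \<rho> c"
    using \<theta> k assms
    by (auto simp: focal_pencil_eq G_op_pencil_conic H_op_pencil_conic)
qed (use comm_group_pencil_ops[OF assms] inv_H_map[OF assms] G_map_compose[OF assms] in \<open>blast+\<close>)

end
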